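(* As formal power series in $q$ (equivalently, for complex $q$ with $|q|<1$), $$\sum_{n\ge 0}\frac{q^{2n^2+2n}}{(q;q)_{2n+1}}=\frac{1}{(q;q)_\infty}\sum_{k\in\mathbb{Z}}\left(q^{12k^2+5k}-q^{12k^2-13k+3}\right).$$
   Context: $(q;q)_n=\prod_{j=1}^{n}(1-q^j)$ and $(q;q)_\infty=\prod_{j\ge1}(1-q^j)$. *)

theory Defs
  imports "HOL-Analysis.Analysis"
begin

definition qpoch :: "'a::comm_ring_1 \<Rightarrow> nat \<Rightarrow> 'a" where
  "qpoch q n = (\<Prod>j=1..n. 1 - q ^ j)"

text \<open>
  The index is shifted, so that the factors are \<open>1 - q ^ j\<close> for \<open>j \<ge> 1\<close>. The limit is taken in the
  topology of the type: coefficientwise (X-adic) for formal power series, the usual one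
  for complex numbers.
\<close>

definition qpoch_inf :: "'a::{t2_space, comm_ring_1} \<Rightarrow> 'a" where
  "qpoch_inf q = (\<Prod>j. 1 - q ^ Suc j)"

text \<open>
  The two quadratic exponents are natural numbers for every integer \<open>k\<close>, so that
  \<^const>\<open>nat\<close> can be applied to them without truncation.
\<close>

lemma exponent1_nonneg: "12 * k^2 + 5 * k \<ge> (0::int)"
proof -
  have "12 * k^2 + 5 * k = k * (12 * k + 5)"
    by (simp add: power2_eq_square algebra_simps)
  moreover have "k * (12 * k + 5) \<ge> 0"
    by (cases "k \<ge> 0") (auto intro: mult_nonneg_nonneg mult_nonpos_nonpos)
  ultimately show ?thesis by simp
qed

lemma exponent2_nonneg: "12 * k^2 - 13 * k + 3 \<ge> (0::int)"
proof -
  have "12 * k^2 - 13 * k + 3 = (3 * k - 1) * (4 * k - 3)"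
    by (simp add: power2_eq_square algebra_simps)
  moreover have "(3 * k - 1) * (4 * k - 3) \<ge> 0"
    by (cases "k \<ge> 1") (auto intro: mult_nonneg_nonneg mult_nonpos_nonpos)
  ultimately show ?thesis by simp
qed

end

theory Submission
  imports Defs "HOL-Computational_Algebra.Formal_Laurent_Series"
begin

text \<open>
  Put \<open>q = w\<^sup>2\<close>. Euler's expansion of the product of the \<open>1 - w ^ (2 * j + 1)\<close> is the sum of
  \<open>(- 1) ^ m * w ^ (m\<^sup>2) / (q;q)\<^sub>m\<close>, and multiplying it by \<open>(q;q)\<close> at infinity gives \<open>(w;w)\<close> at
  infinity, which is the pentagonal number series in \<open>w\<close>. The claim is the comparison of the
  parts that are odd in \<open>w\<close>: since \<open>(2 * n + 1)\<^sup>2 = 2 * (2 * n\<^sup>2 + 2 * n) + 1\<close>, the terms with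
  odd \<open>m\<close> give the left-hand side, and the odd pentagonal numbers \<open>k * (3 * k + 1) / 2\<close> occur
  for \<open>k = - 1 - 4 * j\<close> and \<open>k = 2 - 4 * j\<close>, where they give the two exponents on the right.
\<close>

section \<open>Valued rings\<close>

text \<open>
  The complex numbers with their absolute value and the formal power series over a field with
  \<open>2\<close> to the power minus the subdegree are both complete for a multiplicative norm, so that all
  limit arguments can be carried out for the two cases at once.
\<close>

class valued_ring = idom + complete_space +
  assumes dist_add_right: "dist (x + z) (y + z) = dist x y"
    and dist_mult_zero: "dist (x * y) 0 = dist x 0 * dist y 0"

definition vnorm :: "'a::valued_ring \<Rightarrow> real" where
  "vnorm x = dist x 0"

lemma vnorm_nonneg [simp]: "0 \<le> vnorm x"
  and vnorm_zero [simp]: "vnorm 0 = 0"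
  and vnorm_eq_zero_iff: "vnorm x = 0 \<longleftrightarrow> x = 0"
  and vnorm_mult: "vnorm (x * y) = vnorm x * vnorm y"
  by (simp_all add: vnorm_def dist_mult_zero)

lemma dist_conv_vnorm: "dist x y = vnorm (x - y)"
  using dist_add_right[of "x - y" y 0] by (simp add: vnorm_def)

lemma vnorm_minus [simp]: "vnorm (- x) = vnorm x"
  using dist_conv_vnorm[of 0 x] by (simp add: vnorm_def dist_commute)

lemma vnorm_add_le: "vnorm (x + y) \<le> vnorm x + vnorm y"
  using dist_triangle[of "x + y" 0 y] dist_add_right[of x y 0] by (simp add: vnorm_def)

lemma vnorm_diff_le: "vnorm (x - y) \<le> vnorm x + vnorm y"
  using vnorm_add_le[of x "- y"] by simp

lemma vnorm_one [simp]: "vnorm (1 :: 'a::valued_ring) = 1"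
  using vnorm_mult[of "1::'a" 1] vnorm_eq_zero_iff[of "1::'a"] by simp

lemma vnorm_power: "vnorm (x ^ n) = vnorm x ^ n"
  by (induction n) (simp_all add: vnorm_mult)

lemma vnorm_prod: "vnorm (\<Prod>i\<in>A. f i) = (\<Prod>i\<in>A. vnorm (f i))"
  by (induction A rule: infinite_finite_induct) (simp_all add: vnorm_mult)

lemma vnorm_sum_le: "vnorm (\<Sum>i\<in>A. f i) \<le> (\<Sum>i\<in>A. vnorm (f i))"
proof (induction A rule: infinite_finite_induct)
  case (insert x F)
  then show ?case using vnorm_add_le[of "f x" "sum f F"] by simp
qed simp_all

lemma vnorm_sum_mono:
  assumes "\<And>i. i \<in> A \<Longrightarrow> vnorm (f i) \<le> g i"
  shows "vnorm (\<Sum>i\<in>A. f i) \<le> (\<Sum>i\<in>A. g i)"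
  using vnorm_sum_le[of f A] sum_mono[of A "\<lambda>i. vnorm (f i)" g] assms by fastforce

lemma tendsto_iff_vnorm: "(f \<longlongrightarrow> l) F \<longleftrightarrow> ((\<lambda>x. vnorm (f x - l)) \<longlongrightarrow> 0) F"
  by (simp only: tendsto_dist_iff[of f l F] dist_conv_vnorm)

lemma tendsto_vnorm_sandwich:
  assumes "\<And>x. vnorm (f x - l) \<le> g x" "(g \<longlongrightarrow> 0) F"
  shows "(f \<longlongrightarrow> l) F"
  unfolding tendsto_iff_vnorm[of f l F]
  by (rule tendsto_sandwich[OF _ _ tendsto_const assms(2)]) (simp_all add: assms(1))

lemma tendsto_vnorm:
  assumes "(f \<longlongrightarrow> l) F" shows "((\<lambda>x. vnorm (f x)) \<longlongrightarrow> vnorm l) F"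
  unfolding vnorm_def by (intro tendsto_dist assms tendsto_const)

text \<open>Continuity of the ring operations is not an axiom of \<open>valued_ring\<close>; it is
  derived here from the triangle inequality and multiplicativity of \<open>vnorm\<close>.\<close>

lemma valued_tendsto_add:
  fixes f g :: "_ \<Rightarrow> 'a::valued_ring"
  assumes "(f \<longlongrightarrow> a) F" "(g \<longlongrightarrow> b) F"
  shows "((\<lambda>x. f x + g x) \<longlongrightarrow> a + b) F"
proof -
  have "((\<lambda>x. vnorm (f x - a) + vnorm (g x - b)) \<longlongrightarrow> 0) F"
    using tendsto_add[OF assms[unfolded tendsto_iff_vnorm]] by simp
  moreover have "vnorm (f x + g x - (a + b)) \<le> vnorm (f x - a) + vnorm (g x - b)" for x
    using vnorm_add_le[of "f x - a" "g x - b"] by (simp add: algebra_simps)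
  ultimately show ?thesis
    by (intro tendsto_vnorm_sandwich) auto
qed

lemma valued_tendsto_mult:
  fixes f g :: "_ \<Rightarrow> 'a::valued_ring"
  assumes "(f \<longlongrightarrow> a) F" "(g \<longlongrightarrow> b) F"
  shows "((\<lambda>x. f x * g x) \<longlongrightarrow> a * b) F"
proof -
  have "((\<lambda>x. vnorm (f x - a) * vnorm (g x) + vnorm a * vnorm (g x - b))
      \<longlongrightarrow> 0 * vnorm b + vnorm a * 0) F"
    by (intro tendsto_add tendsto_mult tendsto_const tendsto_vnorm
        assms[unfolded tendsto_iff_vnorm] assms(2))
  moreover have "vnorm (f x * g x - a * b) \<le> vnorm (f x - a) * vnorm (g x) + vnorm a * vnorm (g x - b)"
    for x
    using vnorm_add_le[of "(f x - a) * g x" "a * (g x - b)"]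
    by (simp add: algebra_simps flip: vnorm_mult)
  ultimately show ?thesis
    by (intro tendsto_vnorm_sandwich) auto
qed

lemma valued_tendsto_diff:
  fixes f g :: "_ \<Rightarrow> 'a::valued_ring"
  assumes "(f \<longlongrightarrow> a) F" "(g \<longlongrightarrow> b) F"
  shows "((\<lambda>x. f x - g x) \<longlongrightarrow> a - b) F"
  using valued_tendsto_add[OF assms(1) valued_tendsto_mult[OF tendsto_const[of "-1"] assms(2)]]
  by simp

section \<open>Geometric majorants and convergence\<close>

lemma sum_geometric_le:
  fixes r :: real
  assumes "0 \<le> r" "r < 1" "finite A"
  shows "(\<Sum>i\<in>A. r ^ i) \<le> 1 / (1 - r)"
  using sum_le_suminf[of "\<lambda>i. r ^ i" A] assms by (simp add: suminf_geometric summable_geometric)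

text \<open>The triangle inequality along the steps from \<open>m\<close> to \<open>n\<close> leaves
  a geometric sum. Being uniform in \<open>n\<close>, the bound serves for the Cauchy property and
  also survives a passage to the limit.\<close>

lemma vnorm_diff_le_geometric:
  fixes s :: "nat \<Rightarrow> 'a::valued_ring"
  assumes r: "0 \<le> r" "r < 1" and C: "0 \<le> C"
    and s: "\<And>n. vnorm (s (Suc n) - s n) \<le> C * r ^ n"
    and "m \<le> n"
  shows "vnorm (s n - s m) \<le> C * r ^ m / (1 - r)"
proof -
  obtain d where d: "n = m + d" using \<open>m \<le> n\<close> by (metis le_iff_add)
  have "vnorm (s (m + d) - s m) \<le> C * r ^ m * (\<Sum>i<d. r ^ i)"
  proof (induction d)
    case (Suc d)
    have "vnorm (s (m + Suc d) - s m) \<le> vnorm (s (Suc (m + d)) - s (m + d)) + vnorm (s (m + d) - s m)"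
      using vnorm_add_le[of "s (Suc (m + d)) - s (m + d)" "s (m + d) - s m"] by simp
    also have "\<dots> \<le> C * r ^ (m + d) + C * r ^ m * (\<Sum>i<d. r ^ i)"
      by (intro add_mono s Suc.IH)
    finally show ?case by (simp add: algebra_simps power_add)
  qed simp
  also have "\<dots> \<le> C * r ^ m * (1 / (1 - r))"
    using sum_geometric_le[OF r, of "{..<d}"] r C by (intro mult_left_mono) auto
  finally show ?thesis using d by simp
qed

lemma convergent_geometric:
  fixes s :: "nat \<Rightarrow> 'a::valued_ring"
  assumes r: "0 \<le> r" "r < 1" and C: "0 \<le> C"
    and s: "\<And>n. vnorm (s (Suc n) - s n) \<le> C * r ^ n"
  shows "convergent s"
proof (rule Cauchy_convergent, rule metric_CauchyI)
  fix e :: real assume "0 < e"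
  have "(\<lambda>m. C * r ^ m / (1 - r)) \<longlonglongrightarrow> C * 0 / (1 - r)"
    using r by (intro tendsto_intros LIMSEQ_realpow_zero) auto
  then have "\<forall>\<^sub>F m in sequentially. C * r ^ m / (1 - r) < e / 2"
    using \<open>0 < e\<close> by (intro order_tendstoD(2)[where a = "e/2"]) auto
  then obtain M where M: "C * r ^ M / (1 - r) < e / 2"
    by (auto simp: eventually_sequentially)
  have close: "dist (s n) (s M) < e / 2" if "n \<ge> M" for n
    using vnorm_diff_le_geometric[OF r C s that] M
    unfolding dist_conv_vnorm by (rule le_less_trans)
  show "\<exists>M. \<forall>m\<ge>M. \<forall>n\<ge>M. dist (s m) (s n) < e"
    using dist_triangle_half_l[OF close close] by blast
qed

lemma LIMSEQ_le_geometric: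
  fixes s :: "nat \<Rightarrow> 'a::valued_ring"
  assumes r: "0 \<le> r" "r < 1"
    and s: "\<And>n. vnorm (s n - t n) \<le> C * r ^ n" and t: "t \<longlonglongrightarrow> l"
  shows "s \<longlonglongrightarrow> l"
proof -
  have "(\<lambda>n. C * r ^ n) \<longlonglongrightarrow> C * 0"
    using r by (intro tendsto_intros LIMSEQ_realpow_zero) auto
  then have "(\<lambda>n. s n - t n) \<longlonglongrightarrow> 0"
    using s by (intro tendsto_vnorm_sandwich) auto
  from valued_tendsto_add[OF this t] show ?thesis by simp
qed


text \<open>An unordered sum may be evaluated along any exhaustion by finite sets; symmetric
  intervals and unions of residue blocks will both be used.\<close>

lemma has_sum_imp_LIMSEQ:
  fixes f :: "'i \<Rightarrow> 'a::{comm_monoid_add, topological_space}"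
  assumes f: "(f has_sum l) UNIV"
    and fin: "\<And>n. finite (A n)"
    and exh: "\<And>i. \<forall>\<^sub>F n in sequentially. i \<in> A n"
  shows "(\<lambda>n. \<Sum>i\<in>A n. f i) \<longlonglongrightarrow> l"
proof -
  have "filterlim A (finite_subsets_at_top UNIV) sequentially"
    unfolding filterlim_finite_subsets_at_top
  proof (intro allI impI)
    fix X :: "'i set" assume "finite X \<and> X \<subseteq> UNIV"
    then have "\<forall>\<^sub>F n in sequentially. \<forall>i\<in>X. i \<in> A n"
      using exh by (intro eventually_ball_finite) auto
    then show "\<forall>\<^sub>F n in sequentially. finite (A n) \<and> X \<subseteq> A n \<and> A n \<subseteq> UNIV"
      by eventually_elim (use fin in auto)
  qed
  with f show ?thesis
    unfolding has_sum_def by (rule filterlim_compose)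
qed

text \<open>A finite set containing \<open>{- int n..int n}\<close> adds only indices of absolute
  value above \<open>n\<close>, and each absolute value occurs at most twice. Hence the symmetric
  partial sums already determine the unordered sum.\<close>

lemma has_sum_int_geometric:
  fixes f :: "int \<Rightarrow> 'a::valued_ring"
  assumes r: "0 \<le> r" "r < 1" and C: "0 \<le> C"
    and f: "\<And>k. vnorm (f k) \<le> C * r ^ nat \<bar>k\<bar>"
    and lim: "(\<lambda>n. \<Sum>k\<in>{- int n..int n}. f k) \<longlonglongrightarrow> l"
  shows "(f has_sum l) UNIV"
  unfolding has_sum_def tendsto_iff eventually_finite_subsets_at_top
proof (intro allI impI)
  fix e :: real assume "0 < e"
  have "(\<lambda>m. 2 * C * r ^ m / (1 - r)) \<longlonglongrightarrow> 2 * C * 0 / (1 - r)"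
    using r by (intro tendsto_intros LIMSEQ_realpow_zero) auto
  then have "\<forall>\<^sub>F m in sequentially. 2 * C * r ^ m / (1 - r) < e / 2"
    using \<open>0 < e\<close> by (intro order_tendstoD(2)[where a = "e/2"]) auto
  moreover have "\<forall>\<^sub>F n in sequentially. dist (\<Sum>k\<in>{- int n..int n}. f k) l < e / 2"
    using tendstoD[OF lim, of "e / 2"] \<open>0 < e\<close> by simp
  ultimately have "\<forall>\<^sub>F n in sequentially. 2 * C * r ^ n / (1 - r) < e / 2 \<and>
      dist (\<Sum>k\<in>{- int n..int n}. f k) l < e / 2"
    by (rule eventually_conj)
  then obtain n where n: "2 * C * r ^ n / (1 - r) < e / 2"
      "dist (\<Sum>k\<in>{- int n..int n}. f k) l < e / 2"
    by (auto simp: eventually_sequentially)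
  define X where "X = {- int n..int n}"
  have "dist (sum f Y) l < e" if Y: "finite Y" "X \<subseteq> Y" for Y
  proof -
    define Z where "Z = Y - X"
    have Z: "finite Z" "\<And>k. k \<in> Z \<Longrightarrow> n < nat \<bar>k\<bar>"
      using Y by (force simp: Z_def X_def)+
    \<comment> \<open>The excesses of the absolute values over \<open>n\<close>: the extra indices
      lie in two mirror images of \<open>N\<close>, and each image costs one geometric sum.\<close>
    define N where "N = (\<lambda>k. nat \<bar>k\<bar> - n) ` Z"
    have N: "finite N" using Z by (simp add: N_def)
    have "vnorm (sum f Y - sum f X) = vnorm (sum f Z)"
      using Y by (simp add: Z_def sum_diff)
    also have "\<dots> \<le> (\<Sum>k\<in>Z. C * r ^ nat \<bar>k\<bar>)"
      by (intro vnorm_sum_mono f)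
    also have "\<dots> \<le> (\<Sum>k\<in>(\<lambda>i. int (n + i)) ` N \<union> (\<lambda>i. - int (n + i)) ` N. C * r ^ nat \<bar>k\<bar>)"
    proof (rule sum_mono2)
      show "Z \<subseteq> (\<lambda>i. int (n + i)) ` N \<union> (\<lambda>i. - int (n + i)) ` N"
      proof
        fix k assume k: "k \<in> Z"
        then have "nat \<bar>k\<bar> - n \<in> N" by (simp add: N_def)
        moreover have "k = int (n + (nat \<bar>k\<bar> - n)) \<or> k = - int (n + (nat \<bar>k\<bar> - n))"
          using Z(2)[OF k] by linarith
        ultimately show "k \<in> (\<lambda>i. int (n + i)) ` N \<union> (\<lambda>i. - int (n + i)) ` N"
          by blast
      qed
    qed (use N C r in auto)
    also have "\<dots> \<le> (\<Sum>k\<in>(\<lambda>i. int (n + i)) ` N. C * r ^ nat \<bar>k\<bar>) +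
        (\<Sum>k\<in>(\<lambda>i. - int (n + i)) ` N. C * r ^ nat \<bar>k\<bar>)"
      using N C r by (subst sum.union_inter[symmetric]) (auto intro!: sum_nonneg)
    also have "(\<Sum>k\<in>(\<lambda>i. int (n + i)) ` N. C * r ^ nat \<bar>k\<bar>) = (\<Sum>i\<in>N. C * r ^ (n + i))"
      by (subst sum.reindex) (simp_all add: inj_on_def del: of_nat_add)
    also have "(\<Sum>k\<in>(\<lambda>i. - int (n + i)) ` N. C * r ^ nat \<bar>k\<bar>) = (\<Sum>i\<in>N. C * r ^ (n + i))"
      by (subst sum.reindex) (simp_all add: inj_on_def del: of_nat_add)
    also have "(\<Sum>i\<in>N. C * r ^ (n + i)) + (\<Sum>i\<in>N. C * r ^ (n + i))
        = 2 * C * r ^ n * (\<Sum>i\<in>N. r ^ i)"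
      by (simp add: power_add sum_distrib_left mult_ac)
    also have "\<dots> \<le> 2 * C * r ^ n * (1 / (1 - r))"
      using sum_geometric_le[OF r N] r C by (intro mult_left_mono) auto
    also have "\<dots> < e / 2" using n(1) by simp
    finally have "dist (sum f Y) (sum f X) < e / 2" by (simp add: dist_conv_vnorm)
    then show ?thesis
      using n(2) dist_triangle_half_r[of "sum f X" "sum f Y" e l] by (simp add: X_def dist_commute)
  qed
  then show "\<exists>X. finite X \<and> X \<subseteq> UNIV \<and>
      (\<forall>Y. finite Y \<and> X \<subseteq> Y \<and> Y \<subseteq> UNIV \<longrightarrow> dist (sum f Y) l < e)"
    by (intro exI[of _ X]) (auto simp: X_def)
qed

lemma int_interval_Suc:
  "{- int (Suc n)..int (Suc n)} = insert (int (Suc n)) (insert (- int (Suc n)) {- int n..int n})"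
  by auto

text \<open>By completeness the symmetric partial sums converge, since each step adds just two
  terms; \<open>has_sum_int_geometric\<close> upgrades this to unordered summability.\<close>

lemma summable_on_int_geometric:
  fixes f :: "int \<Rightarrow> 'a::valued_ring"
  assumes r: "0 \<le> r" "r < 1" and C: "0 \<le> C"
    and f: "\<And>k. vnorm (f k) \<le> C * r ^ nat \<bar>k\<bar>"
  shows "f summable_on UNIV"
proof -
  define s where "s n = (\<Sum>k\<in>{- int n..int n}. f k)" for n
  have "vnorm (s (Suc n) - s n) \<le> 2 * C * r ^ n" for n
  proof -
    have "s (Suc n) - s n = f (int (Suc n)) + f (- int (Suc n))"
      unfolding s_def int_interval_Suc by simp
    also have "vnorm \<dots> \<le> C * r ^ Suc n + C * r ^ Suc n"
      using f[of "int (Suc n)"] f[of "- int (Suc n)"]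
        vnorm_add_le[of "f (int (Suc n))" "f (- int (Suc n))"]
      by (simp add: nat_add_distrib del: of_nat_Suc)
    also have "\<dots> \<le> 2 * C * r ^ n"
      using r C mult_left_le_one_le[of "r ^ n" r] mult_left_mono[of "r * r ^ n" "r ^ n" C] by simp
    finally show ?thesis .
  qed
  then have "convergent s" using r C by (intro convergent_geometric[where C = "2 * C" and r = r]) auto
  then obtain l where "s \<longlonglongrightarrow> l" by (auto simp: convergent_def)
  then show ?thesis
    using has_sum_int_geometric[OF r C f, of l] unfolding s_def summable_on_def by blast
qed

section \<open>Uniform bounds for finite products\<close>

lemma prod_one_plus_power_le:
  fixes r :: real
  assumes r: "0 \<le> r" "r < 1" and A: "finite A"
  shows "(\<Prod>j\<in>A. 1 + r ^ j) \<le> exp (1 / (1 - r))"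
proof -
  have "(\<Prod>j\<in>A. 1 + r ^ j) \<le> (\<Prod>j\<in>A. exp (r ^ j))"
    using r by (intro prod_mono) auto
  also have "\<dots> = exp (\<Sum>j\<in>A. r ^ j)" using A by (simp add: exp_sum)
  also have "\<dots> \<le> exp (1 / (1 - r))" using sum_geometric_le[OF r A] by simp
  finally show ?thesis .
qed

text \<open>From \<open>r ^ j \<le> r\<close> follows
  \<open>1 / (1 - r ^ j) \<le> 1 + r ^ j / (1 - r)\<close>, which is at most an exponential; the
  exponents then add up to a geometric sum.\<close>

lemma prod_one_minus_power_ge:
  fixes r :: real
  assumes r: "0 \<le> r" "r < 1" and A: "finite A" "0 \<notin> A"
  shows "exp (- (1 / (1 - r)\<^sup>2)) \<le> (\<Prod>j\<in>A. 1 - r ^ j)"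
proof -
  have factor: "exp (- (r ^ j / (1 - r))) \<le> 1 - r ^ j" if "j \<in> A" for j
  proof -
    have "0 < j" using that A by (cases j) auto
    then have rj: "r ^ j \<le> r" using r power_decreasing[of 1 j r] by simp
    then have lt: "0 < 1 - r ^ j" using r by simp
    have "1 / (1 - r ^ j) = 1 + r ^ j / (1 - r ^ j)" using lt by (simp add: field_simps)
    also have "\<dots> \<le> 1 + r ^ j / (1 - r)" using rj r by (intro add_left_mono divide_left_mono) auto
    also have "\<dots> \<le> exp (r ^ j / (1 - r))" by (rule exp_ge_add_one_self)
    finally have "1 / exp (r ^ j / (1 - r)) \<le> 1 - r ^ j" using lt by (simp add: field_simps)
    then show ?thesis by (simp add: exp_minus field_simps)
  qed
  have "(\<Sum>j\<in>A. r ^ j / (1 - r)) \<le> 1 / (1 - r) / (1 - r)"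
    using divide_right_mono[OF sum_geometric_le[OF r A(1)], of "1 - r"] r
    by (simp add: sum_divide_distrib)
  then have "exp (- (1 / (1 - r)\<^sup>2)) \<le> exp (\<Sum>j\<in>A. - (r ^ j / (1 - r)))"
    by (simp add: power2_eq_square sum_negf)
  also have "\<dots> = (\<Prod>j\<in>A. exp (- (r ^ j / (1 - r))))" using A by (simp add: exp_sum)
  also have "\<dots> \<le> (\<Prod>j\<in>A. 1 - r ^ j)" by (intro prod_mono) (simp add: factor)
  finally show ?thesis .
qed

lemma vnorm_prod_le:
  fixes x :: "'a::valued_ring"
  assumes "vnorm x < 1" "finite A"
  shows "vnorm (\<Prod>j\<in>A. 1 - x ^ j) \<le> exp (1 / (1 - vnorm x))"
proof -
  have "vnorm (\<Prod>j\<in>A. 1 - x ^ j) \<le> (\<Prod>j\<in>A. 1 + vnorm x ^ j)"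
    unfolding vnorm_prod using vnorm_diff_le[of 1] by (intro prod_mono) (simp flip: vnorm_power)
  also have "\<dots> \<le> exp (1 / (1 - vnorm x))"
    using assms by (intro prod_one_plus_power_le) auto
  finally show ?thesis .
qed

text \<open>A positive lower bound independent of \<open>n\<close> keeps the limit of the products
  away from zero and bounds all reciprocals at once.\<close>

lemma vnorm_qpoch_ge:
  fixes x :: "'a::valued_ring"
  assumes "vnorm x < 1"
  shows "exp (- (1 / (1 - vnorm x)\<^sup>2)) \<le> vnorm (qpoch x n)"
proof -
  have "exp (- (1 / (1 - vnorm x)\<^sup>2)) \<le> (\<Prod>j=1..n. 1 - vnorm x ^ j)"
    using assms by (intro prod_one_minus_power_ge) auto
  also have "\<dots> \<le> (\<Prod>j=1..n. vnorm (1 - x ^ j))"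
  proof (rule prod_mono, intro conjI)
    fix j
    show "0 \<le> 1 - vnorm x ^ j" using assms by (simp add: power_le_one)
    show "1 - vnorm x ^ j \<le> vnorm (1 - x ^ j)"
      using vnorm_add_le[of "1 - x ^ j" "x ^ j"] by (simp add: vnorm_power)
  qed
  finally show ?thesis by (simp add: qpoch_def vnorm_prod)
qed

section \<open>Convergence to a nonzero infinite product\<close>

lemma qpoch_0 [simp]: "qpoch x 0 = 1"
  and qpoch_Suc: "qpoch x (Suc n) = qpoch x n * (1 - x ^ Suc n)"
  by (simp_all add: qpoch_def)

lemma qpoch_nonzero:
  fixes x :: "'a::valued_ring"
  assumes x: "vnorm x < 1"
  shows "qpoch x n \<noteq> 0"
  using vnorm_qpoch_ge[OF x, of n] exp_gt_zero[of "- (1 / (1 - vnorm x)\<^sup>2)"]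
  by (auto simp del: exp_gt_zero)

lemma qpoch_limit_nonzero:
  fixes x :: "'a::valued_ring"
  assumes x: "vnorm x < 1" and l: "qpoch x \<longlonglongrightarrow> l"
  shows "l \<noteq> 0"
proof -
  have "exp (- (1 / (1 - vnorm x)\<^sup>2)) \<le> vnorm l"
    using vnorm_qpoch_ge[OF x] by (intro LIMSEQ_le_const[OF tendsto_vnorm[OF l]]) auto
  then show ?thesis
    using exp_gt_zero[of "- (1 / (1 - vnorm x)\<^sup>2)"] by (auto simp del: exp_gt_zero)
qed

lemma convergent_qpoch:
  fixes x :: "'a::valued_ring"
  assumes x: "vnorm x < 1"
  shows "convergent (qpoch x)"
proof (rule convergent_geometric)
  fix n
  have "qpoch x (Suc n) - qpoch x n = - (x ^ Suc n * qpoch x n)"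
    by (simp add: qpoch_Suc algebra_simps)
  then have "vnorm (qpoch x (Suc n) - qpoch x n) = vnorm (qpoch x n) * vnorm x ^ Suc n"
    by (simp add: vnorm_mult vnorm_power mult_ac del: power_Suc)
  also have "\<dots> \<le> exp (1 / (1 - vnorm x)) * vnorm x ^ n"
    using x vnorm_prod_le[OF x, of "{1..n}"]
    by (intro mult_mono) (auto simp: qpoch_def mult_left_le_one_le)
  finally show "vnorm (qpoch x (Suc n) - qpoch x n) \<le> exp (1 / (1 - vnorm x)) * vnorm x ^ n" .
qed (use x in auto)

text \<open>Besides convergence of the partial products, \<open>raw_has_prod\<close> demands a
  nonzero limit, which \<open>qpoch_limit_nonzero\<close> supplies.\<close>

lemma has_prod_qpoch:
  fixes x :: "'a::valued_ring"
  assumes x: "vnorm x < 1"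
  shows "(\<lambda>j. 1 - x ^ Suc j) has_prod lim (qpoch x)"
proof -
  have lim: "qpoch x \<longlonglongrightarrow> lim (qpoch x)"
    using convergent_qpoch[OF x] by (simp add: convergent_LIMSEQ_iff)
  have "qpoch x (Suc n) = (\<Prod>i\<le>n. 1 - x ^ Suc i)" for n
    unfolding qpoch_def by (rule prod.reindex_bij_witness[of _ Suc "\<lambda>i. i - 1"]) auto
  then have "(\<lambda>n. \<Prod>i\<le>n. 1 - x ^ Suc i) \<longlonglongrightarrow> lim (qpoch x)"
    using LIMSEQ_Suc[OF lim] by simp
  then show ?thesis
    using qpoch_limit_nonzero[OF x lim] by (simp add: has_prod_def raw_has_prod_def)
qed

lemma qpoch_LIMSEQ:
  fixes x :: "'a::valued_ring"
  assumes x: "vnorm x < 1"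
  shows "qpoch x \<longlonglongrightarrow> qpoch_inf x"
  using convergent_qpoch[OF x] has_prod_unique[OF has_prod_qpoch[OF x]]
  by (simp add: convergent_LIMSEQ_iff qpoch_inf_def)

section \<open>The pentagonal number theorem and Euler's series\<close>

lemma summable_geometric_bound:
  fixes t :: "nat \<Rightarrow> 'a::valued_ring"
  assumes "0 \<le> r" "r < 1" "0 \<le> C" "\<And>n. vnorm (t n) \<le> C * r ^ n"
  shows "summable t"
proof -
  have "convergent (\<lambda>n. \<Sum>i<n. t i)"
    using assms by (intro convergent_geometric[of r C]) auto
  then show ?thesis by (simp add: summable_iff_convergent)
qed

text \<open>The generalized pentagonal numbers. The product is even and nonnegative for every
  integer \<open>k\<close>, so neither \<open>div\<close> nor \<open>nat\<close> loses
  anything.\<close>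

definition pent :: "int \<Rightarrow> nat" where
  "pent k = nat (k * (3 * k + 1) div 2)"

lemma pentI:
  assumes "k * (3 * k + 1) = 2 * int e" shows "pent k = e"
  using assms by (simp add: pent_def)

lemma two_gauss: "2 * (\<Sum>i\<le>n. int i) = int n * (int n + 1)"
  by (induction n) (simp_all add: algebra_simps)

text \<open>A product plus a triangular number is the shape of the exponents in Shanks's finite sum
  below.\<close>

lemma pent_of_nat: "pent (int n) = n * n + \<Sum>{..n}"
  by (rule pentI) (use two_gauss[of n] in \<open>simp add: algebra_simps\<close>)

lemma pent_minus_of_nat: "pent (- int (Suc n)) = Suc n * n + \<Sum>{..Suc n}"
  by (rule pentI) (use two_gauss[of n] in \<open>simp add: algebra_simps\<close>)

lemma pent_ge: "nat \<bar>k\<bar> \<le> pent k"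
proof (cases k rule: int_cases)
  case (nonneg n)
  then show ?thesis by (cases n) (simp_all add: pent_of_nat del: of_nat_Suc)
next
  case (neg n)
  then show ?thesis by (simp add: pent_minus_of_nat del: of_nat_Suc)
qed

text \<open>The sign is \<open>(- 1) ^ k\<close>, expressed by parity because \<open>k\<close> may
  be negative.\<close>

definition pent_term :: "'a::comm_ring_1 \<Rightarrow> int \<Rightarrow> 'a" where
  "pent_term x k = (if even k then 1 else - 1) * x ^ pent k"

lemma pent_term_of_nat: "pent_term x (int n) = (- 1) ^ n * x ^ (n * n + \<Sum>{..n})"
  and pent_term_minus_of_nat:
    "pent_term x (- int (Suc n)) = (- 1) ^ Suc n * x ^ (Suc n * n + \<Sum>{..Suc n})"
  by (simp_all only: pent_term_def pent_of_nat pent_minus_of_nat) auto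

section \<open>Shanks's finite form of the pentagonal number theorem\<close>

lemma prod_greaterThanAtMost_Suc:
  fixes f :: "nat \<Rightarrow> 'a::comm_monoid_mult"
  assumes "k \<le> n"
  shows "(\<Prod>j\<in>{k<..Suc n}. f j) = (\<Prod>j\<in>{k<..n}. f j) * f (Suc n)"
proof -
  have "{k<..Suc n} = insert (Suc n) {k<..n}" using assms by auto
  then show ?thesis by (simp add: mult.commute)
qed

lemma prod_greaterThanAtMost_head:
  fixes f :: "nat \<Rightarrow> 'a::comm_monoid_mult"
  assumes "k < n"
  shows "(\<Prod>j\<in>{k<..n}. f j) = f (Suc k) * (\<Prod>j\<in>{Suc k<..n}. f j)"
proof -
  have "{k<..n} = insert (Suc k) {Suc k<..n}" using assms by auto
  then show ?thesis by simp
qed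

text \<open>The summands are the differences between Shanks's terms for \<open>Suc n\<close> and for
  \<open>n\<close>. They telescope: each new one cancels against the head factor of the product in
  the previous closed form.\<close>

lemma shanks_telescope:
  fixes x :: "'a::comm_ring_1"
  assumes "m \<le> n"
  shows "(\<Sum>k\<le>m. (- 1) ^ k * (\<Prod>j\<in>{k<..n}. 1 - x ^ j) * x ^ (n * k + \<Sum>{..k}) * ((1 - x ^ Suc n) * x ^ k - 1))
    = (- 1) ^ Suc m * (\<Prod>j\<in>{m<..n}. 1 - x ^ j) * x ^ (n * Suc m + \<Sum>{..Suc m})"
  using assms
proof (induction m)
  case 0
  then show ?case by simp
next
  case (Suc m)
  \<comment> \<open>Here \<open>u\<close> is \<open>x ^ Suc m\<close>, \<open>v\<close> is
    \<open>x ^ Suc n\<close> and \<open>p\<close> is the product without its head factor; the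
    cancellation is \<open>(1 - u) + ((1 - v) * u - 1) = - v * u\<close>.\<close>
  have alg: "a * ((1 - u) * p) * e + a * p * e * ((1 - v) * u - 1) = - a * p * (e * v * u)"
    for a e p u v :: 'a
    by (simp add: algebra_simps)
  have "(\<Sum>k\<le>Suc m. (- 1) ^ k * (\<Prod>j\<in>{k<..n}. 1 - x ^ j) * x ^ (n * k + \<Sum>{..k}) * ((1 - x ^ Suc n) * x ^ k - 1))
    = (- 1) ^ Suc m * ((1 - x ^ Suc m) * (\<Prod>j\<in>{Suc m<..n}. 1 - x ^ j)) * x ^ (n * Suc m + \<Sum>{..Suc m})
      + (- 1) ^ Suc m * (\<Prod>j\<in>{Suc m<..n}. 1 - x ^ j) * x ^ (n * Suc m + \<Sum>{..Suc m})
        * ((1 - x ^ Suc n) * x ^ Suc m - 1)"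
    using Suc prod_greaterThanAtMost_head[of m n "\<lambda>j. 1 - x ^ j"] by simp
  also have "\<dots> = (- 1) ^ Suc (Suc m) * (\<Prod>j\<in>{Suc m<..n}. 1 - x ^ j)
      * (x ^ (n * Suc m + \<Sum>{..Suc m}) * x ^ Suc n * x ^ Suc m)"
    unfolding alg by simp
  also have "x ^ (n * Suc m + \<Sum>{..Suc m}) * x ^ Suc n * x ^ Suc m
      = x ^ (n * Suc (Suc m) + \<Sum>{..Suc (Suc m)})"
    by (simp only: power_add[symmetric]) (simp add: algebra_simps)
  finally show ?case .
qed

text \<open>In the step from \<open>n\<close> to \<open>Suc n\<close>, the telescoped difference is
  the pentagonal term at \<open>- int (Suc n)\<close>, and the new top summand is the one at
  \<open>int (Suc n)\<close>.\<close>

lemma shanks_finite_pentagonal: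
  fixes x :: "'a::comm_ring_1"
  shows "(\<Sum>k\<in>{- int n..int n}. pent_term x k)
    = (\<Sum>k\<le>n. (- 1) ^ k * (\<Prod>j\<in>{k<..n}. 1 - x ^ j) * x ^ (n * k + \<Sum>{..k}))"
proof (induction n)
  case 0
  then show ?case by (simp add: pent_term_def pent_def)
next
  case (Suc n)
  let ?t = "\<lambda>n k. (- 1) ^ k * (\<Prod>j\<in>{k<..n}. 1 - x ^ j) * x ^ (n * k + \<Sum>{..k})"
  have alg: "a * (p * (1 - v)) * (e * u) = a * p * e + a * p * e * ((1 - v) * u - 1)"
    for a e p u v :: 'a
    by (simp add: algebra_simps)
  have "?t (Suc n) k = ?t n k + ?t n k * ((1 - x ^ Suc n) * x ^ k - 1)" if "k \<le> n" for k
  proof -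
    have "x ^ (Suc n * k + \<Sum>{..k}) = x ^ (n * k + \<Sum>{..k}) * x ^ k"
      by (simp only: power_add[symmetric]) (simp add: algebra_simps)
    then show ?thesis
      by (simp only: prod_greaterThanAtMost_Suc[OF that] alg)
  qed
  then have "(\<Sum>k\<le>n. ?t (Suc n) k)
      = (\<Sum>k\<le>n. ?t n k) + (\<Sum>k\<le>n. ?t n k * ((1 - x ^ Suc n) * x ^ k - 1))"
    by (simp only: sum.distrib[symmetric]) (intro sum.cong, auto)
  also have "\<dots> = (\<Sum>k\<le>n. ?t n k) + (- 1) ^ Suc n * x ^ (n * Suc n + \<Sum>{..Suc n})"
    using shanks_telescope[of n n x] by simp
  finally have "(\<Sum>k\<le>Suc n. ?t (Suc n) k) = (\<Sum>k\<le>n. ?t n k)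
      + pent_term x (- int (Suc n)) + pent_term x (int (Suc n))"
    by (simp only: sum.atMost_Suc pent_term_of_nat pent_term_minus_of_nat) (simp add: mult.commute)
  then show ?case
    unfolding int_interval_Suc Suc.IH[symmetric] by simp
qed

text \<open>In Shanks's sum the summand \<open>k = 0\<close> is \<open>qpoch x n\<close>. The others
  carry exponents of at least \<open>n + k\<close>, so the pentagonal partial sums and the partial
  products differ by a multiple of \<open>r ^ n\<close>.\<close>

lemma pentagonal:
  fixes x :: "'a::valued_ring"
  assumes x: "vnorm x < 1"
  shows "(pent_term x has_sum qpoch_inf x) UNIV"
proof (rule has_sum_int_geometric[where C = 1])
  define r where "r = vnorm x"
  have r: "0 \<le> r" "r < 1" using x by (auto simp: r_def)
  define K where "K = exp (1 / (1 - r))"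
  define s where "s n = (\<Sum>k\<in>{- int n..int n}. pent_term x k)" for n
  show "vnorm (pent_term x k) \<le> 1 * vnorm x ^ nat \<bar>k\<bar>" for k
  proof -
    have "vnorm (pent_term x k) = r ^ pent k"
      by (simp add: pent_term_def vnorm_mult vnorm_power r_def)
    also have "\<dots> \<le> r ^ nat \<bar>k\<bar>" using r pent_ge by (intro power_decreasing) auto
    finally show ?thesis by (simp add: r_def)
  qed
  have "vnorm (s n - qpoch x n) \<le> K / (1 - r) * r ^ n" for n
  proof -
    let ?t = "\<lambda>k. (- 1) ^ k * (\<Prod>j\<in>{k<..n}. 1 - x ^ j) * x ^ (n * k + \<Sum>{..k})"
    have "{..n} = insert 0 {1..n}" by auto
    then have "s n = (\<Sum>k\<in>insert 0 {1..n}. ?t k)" by (simp only: s_def shanks_finite_pentagonal)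
    also have "\<dots> = ?t 0 + (\<Sum>k\<in>{1..n}. ?t k)" by (rule sum.insert) auto
    finally have "s n = ?t 0 + (\<Sum>k\<in>{1..n}. ?t k)" .
    then have "s n - qpoch x n = (\<Sum>k\<in>{1..n}. ?t k)"
      by (simp add: qpoch_def atLeastSucAtMost_greaterThanAtMost)
    also have "vnorm \<dots> \<le> (\<Sum>k\<in>{1..n}. K * r ^ n * r ^ k)"
    proof (rule vnorm_sum_mono)
      fix k assume k: "k \<in> {1..n}"
      have "k \<le> \<Sum>{..k}" by (cases k) simp_all
      moreover have "n \<le> n * k" using k by simp
      ultimately have "n + k \<le> n * k + \<Sum>{..k}" by (rule add_mono[rotated])
      then have "r ^ (n * k + \<Sum>{..k}) \<le> r ^ (n + k)"
        using r by (intro power_decreasing) auto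
      then show "vnorm (?t k) \<le> K * r ^ n * r ^ k"
        using vnorm_prod_le[OF x, of "{k<..n}"] r
        by (auto simp: vnorm_mult vnorm_power K_def r_def power_add mult.assoc intro!: mult_mono)
    qed
    also have "\<dots> = K * r ^ n * (\<Sum>k\<in>{1..n}. r ^ k)" by (simp add: sum_distrib_left)
    also have "\<dots> \<le> K * r ^ n * (1 / (1 - r))"
      using sum_geometric_le[OF r] r by (intro mult_left_mono) (auto simp: K_def)
    finally show ?thesis by simp
  qed
  then show "(\<lambda>n. \<Sum>k\<in>{- int n..int n}. pent_term x k) \<longlonglongrightarrow> qpoch_inf x"
    unfolding s_def[symmetric] by (rule LIMSEQ_le_geometric[OF r _ qpoch_LIMSEQ[OF x]])
qed (use x in auto)

section \<open>Euler's series\<close>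

lemma vnorm_qpoch_inverse_le:
  fixes q :: "'a::valued_ring"
  assumes q: "vnorm q < 1" and rcp: "u * qpoch q m = 1"
  shows "vnorm u \<le> exp (1 / (1 - vnorm q)\<^sup>2)"
proof -
  have "vnorm u * exp (- (1 / (1 - vnorm q)\<^sup>2)) \<le> vnorm u * vnorm (qpoch q m)"
    by (intro mult_left_mono vnorm_qpoch_ge q) auto
  also have "\<dots> = 1" using rcp by (simp flip: vnorm_mult)
  finally show ?thesis by (simp add: exp_minus field_simps)
qed

text \<open>
  Replacing \<open>w ^ (m * m)\<close> by \<open>w ^ (m * m + 2 * N * m)\<close> gives series \<open>F N\<close> that satisfy
  \<open>F N = (1 - w ^ (2 * N + 1)) * F (N + 1)\<close> and tend to \<open>1\<close>. Reciprocals are given as a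
  function \<open>rcp\<close> because the class has no division.
\<close>

lemma euler:
  fixes w :: "'a::valued_ring"
  assumes w: "vnorm w < 1" and rcp: "\<And>m. rcp m * qpoch (w\<^sup>2) m = 1"
  obtains L where "(\<lambda>M. \<Sum>m<M. (- 1) ^ m * w ^ (m * m) * rcp m) \<longlonglongrightarrow> L"
    and "qpoch_inf (w\<^sup>2) * L = qpoch_inf w"
proof -
  define q where "q = w\<^sup>2"
  define r where "r = vnorm w"
  have r: "0 \<le> r" "r < 1" using w by (auto simp: r_def)
  have q: "vnorm q < 1"
    using r by (simp add: q_def vnorm_power power_less_one_iff flip: r_def)
  define K where "K = exp (1 / (1 - vnorm q)\<^sup>2)"
  have K: "0 \<le> K" "vnorm (rcp m) \<le> K" for m
    using vnorm_qpoch_inverse_le[OF q, of "rcp m" m] rcp by (auto simp: K_def q_def)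
  have rcp_0: "rcp 0 = 1" using rcp[of 0] by simp
  have rcp_Suc: "rcp (Suc m) * (1 - w ^ (2 * Suc m)) = rcp m" for m
  proof -
    have "rcp m = rcp (Suc m) * qpoch (w\<^sup>2) (Suc m) * rcp m" using rcp by simp
    also have "\<dots> = rcp (Suc m) * (1 - (w\<^sup>2) ^ Suc m) * (rcp m * qpoch (w\<^sup>2) m)"
      by (simp add: qpoch_Suc mult_ac)
    finally show ?thesis by (simp only: rcp power_mult mult_1_right)
  qed
  define t where "t N m = (- 1) ^ m * w ^ (m * m + 2 * N * m) * rcp m" for N m
  define F where "F N M = (\<Sum>m<M. t N m)" for N M
  \<comment> \<open>Raising \<open>N\<close> by one multiplies the term at \<open>Suc m\<close> by
    \<open>w ^ (2 * Suc m)\<close>. The difference thus contains the last factor of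
    \<open>qpoch (w\<^sup>2) (Suc m)\<close>, and \<open>rcp_Suc\<close> turns it into a term at
    \<open>m\<close>.\<close>
  have t_Suc: "t N (Suc m) = t (Suc N) (Suc m) - w ^ (2 * N + 1) * t (Suc N) m" for N m
  proof -
    have alg: "a * b * c - a * (b * d) * c = a * b * (c * (1 - d))" for a b c d :: 'a
      by (simp add: algebra_simps)
    have "t (Suc N) (Suc m) = (- 1) ^ Suc m * (w ^ (Suc m * Suc m + 2 * N * Suc m) * w ^ (2 * Suc m)) * rcp (Suc m)"
      unfolding t_def by (simp only: power_add[symmetric]) (simp add: algebra_simps)
    then have "t N (Suc m) - t (Suc N) (Suc m)
        = (- 1) ^ Suc m * w ^ (Suc m * Suc m + 2 * N * Suc m) * (rcp (Suc m) * (1 - w ^ (2 * Suc m)))"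
      by (simp only: t_def alg)
    also have "w ^ (Suc m * Suc m + 2 * N * Suc m) = w ^ (2 * N + 1) * w ^ (m * m + 2 * Suc N * m)"
      by (simp only: power_add[symmetric]) (simp add: algebra_simps)
    finally have "t N (Suc m) - t (Suc N) (Suc m)
        = (- 1) ^ Suc m * (w ^ (2 * N + 1) * w ^ (m * m + 2 * Suc N * m)) * rcp m"
      by (simp only: rcp_Suc)
    also have "\<dots> = - (w ^ (2 * N + 1) * t (Suc N) m)"
      by (simp add: t_def mult.assoc mult.left_commute)
    finally show ?thesis by (simp only: diff_eq_eq) simp
  qed
  \<comment> \<open>The functional equation for partial sums: the index shift in
    \<open>t_Suc\<close> leaves the second sum one term shorter.\<close>
  have F_Suc: "F N (Suc M) = F (Suc N) (Suc M) - w ^ (2 * N + 1) * F (Suc N) M" for N M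
  proof (induction M)
    case 0
    then show ?case by (simp add: F_def t_def)
  next
    case (Suc M)
    have "F N (Suc (Suc M)) = F N (Suc M) + t N (Suc M)" by (simp add: F_def)
    also have "\<dots> = (F (Suc N) (Suc M) + t (Suc N) (Suc M)) - w ^ (2 * N + 1) * (F (Suc N) M + t (Suc N) M)"
      unfolding Suc.IH t_Suc[of N M] by (simp only: algebra_simps)
    finally show ?case by (simp add: F_def)
  qed
  have t_bound: "vnorm (t N (Suc m)) \<le> K * r ^ N * r ^ m" for N m
  proof -
    have "vnorm (t N (Suc m)) = r ^ (Suc m * Suc m + 2 * N * Suc m) * vnorm (rcp (Suc m))"
      by (simp add: t_def vnorm_mult vnorm_power r_def)
    also have "\<dots> \<le> r ^ (N + m) * K"
      using r K by (intro mult_mono power_decreasing) auto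
    finally show ?thesis by (simp add: power_add mult_ac)
  qed
  \<comment> \<open>The shift by one makes \<open>s N 0\<close> the constant term \<open>1\<close>,
    so that \<open>t_bound\<close> covers every increment.\<close>
  define s where "s N n = F N (Suc n)" for N n
  have s_diff: "vnorm (s N (Suc n) - s N n) \<le> K * r ^ N * r ^ n" for N n
    using t_bound[of N n] by (simp add: s_def F_def)
  have "convergent (s N)" for N
    using r K s_diff by (intro convergent_geometric[of r "K * r ^ N"]) auto
  then have lim: "s N \<longlonglongrightarrow> lim (s N)" for N
    by (simp add: convergent_LIMSEQ_iff)
  have limF: "F N \<longlonglongrightarrow> lim (s N)" for N
    by (rule LIMSEQ_imp_Suc) (use lim[of N] in \<open>simp only: s_def[symmetric]\<close>)
  have lim_Suc: "lim (s N) = (1 - w ^ (2 * N + 1)) * lim (s (Suc N))" for N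
  proof -
    have "(\<lambda>M. F (Suc N) (Suc M) - w ^ (2 * N + 1) * F (Suc N) M)
        \<longlonglongrightarrow> lim (s (Suc N)) - w ^ (2 * N + 1) * lim (s (Suc N))"
      using lim[of "Suc N"] limF[of "Suc N"]
      by (intro valued_tendsto_diff valued_tendsto_mult tendsto_const) (simp_all only: s_def[symmetric])
    then have "s N \<longlonglongrightarrow> lim (s (Suc N)) - w ^ (2 * N + 1) * lim (s (Suc N))"
      by (simp only: F_Suc[symmetric]) (simp only: s_def[symmetric])
    then show ?thesis using LIMSEQ_unique[OF lim[of N]] by (simp add: algebra_simps)
  qed
  \<comment> \<open>Iterating the functional equation yields the factors with odd exponents, and
    \<open>qpoch q N\<close> has the even ones; together they form
    \<open>qpoch w (2 * N)\<close>.\<close>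
  have prod: "qpoch q N * lim (s 0) = qpoch w (2 * N) * lim (s N)" for N
  proof (induction N)
    case (Suc N)
    have "qpoch q (Suc N) * lim (s 0) = (1 - q ^ Suc N) * (qpoch w (2 * N) * lim (s N))"
      unfolding Suc.IH[symmetric] by (simp add: qpoch_Suc mult_ac)
    also have "q ^ Suc N = w ^ Suc (Suc (2 * N))"
      unfolding q_def power_mult[symmetric] by simp
    finally show ?case unfolding lim_Suc[of N] by (simp add: qpoch_Suc mult_ac)
  qed simp
  \<comment> \<open>The distance of \<open>s N n\<close> from its first value is bounded uniformly
    in \<open>n\<close>, and the factor \<open>r ^ N\<close> in the bound forces the limits to tend
    to \<open>1\<close>.\<close>
  have "vnorm (lim (s N) - 1) \<le> K / (1 - r) * r ^ N" for N
  proof -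
    have "vnorm (s N n - s N 0) \<le> K * r ^ N * r ^ 0 / (1 - r)" for n
      using r K s_diff by (intro vnorm_diff_le_geometric) auto
    then have "vnorm (s N n - 1) \<le> K / (1 - r) * r ^ N" for n
      by (simp add: s_def F_def t_def rcp_0)
    then show ?thesis
      by (intro LIMSEQ_le_const2[OF tendsto_vnorm[OF valued_tendsto_diff[OF lim tendsto_const]]]) auto
  qed
  then have "(\<lambda>N. lim (s N)) \<longlonglongrightarrow> 1"
    by (rule LIMSEQ_le_geometric[OF r _ tendsto_const])
  moreover have "(\<lambda>N. qpoch w (2 * N)) \<longlonglongrightarrow> qpoch_inf w"
    using LIMSEQ_subseq_LIMSEQ[OF qpoch_LIMSEQ[OF w], of "\<lambda>N. 2 * N"]
    by (simp add: strict_mono_def o_def)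
  ultimately have "(\<lambda>N. qpoch w (2 * N) * lim (s N)) \<longlonglongrightarrow> qpoch_inf w * 1"
    by (rule valued_tendsto_mult[rotated])
  moreover have "(\<lambda>N. qpoch w (2 * N) * lim (s N)) \<longlonglongrightarrow> qpoch_inf q * lim (s 0)"
    unfolding prod[symmetric] by (intro valued_tendsto_mult qpoch_LIMSEQ q tendsto_const)
  ultimately have "qpoch_inf q * lim (s 0) = qpoch_inf w"
    using LIMSEQ_unique by fastforce
  then show ?thesis
    using that[of "lim (s 0)"] limF[of 0] by (simp add: q_def F_def[abs_def] t_def)
qed

section \<open>Even and odd parts\<close>

text \<open>The exponents are the halves of the even pentagonal numbers, with the signs of the
  indices \<open>4 * k\<close> and \<open>4 * k + 1\<close>.\<close>

definition even_term :: "'a::comm_ring_1 \<Rightarrow> int \<Rightarrow> 'a" where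
  "even_term q k = q ^ nat (12 * k\<^sup>2 + k) - q ^ nat (12 * k\<^sup>2 + 7 * k + 1)"

definition odd_term :: "'a::comm_ring_1 \<Rightarrow> int \<Rightarrow> 'a" where
  "odd_term q k = q ^ nat (12 * k^2 + 5 * k) - q ^ nat (12 * k^2 - 13 * k + 3)"

text \<open>These bounds give a geometric majorant in \<open>\<bar>k\<bar>\<close> and ensure that
  \<open>nat\<close> does not truncate.\<close>

lemma exponent_bounds:
  fixes k :: int
  shows "\<bar>k\<bar> \<le> 12 * k\<^sup>2 + k" "\<bar>k\<bar> \<le> 12 * k\<^sup>2 + 7 * k + 1"
    "\<bar>k\<bar> \<le> 12 * k\<^sup>2 + 5 * k" "\<bar>k\<bar> \<le> 12 * k\<^sup>2 - 13 * k + 3"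
proof -
  have "0 \<le> (\<bar>k\<bar> - 1) * \<bar>k\<bar>" by (cases "k = 0") auto
  then have sq: "\<bar>k\<bar> \<le> k\<^sup>2" by (simp add: algebra_simps power2_eq_square)
  then show "\<bar>k\<bar> \<le> 12 * k\<^sup>2 + k" "\<bar>k\<bar> \<le> 12 * k\<^sup>2 + 7 * k + 1" "\<bar>k\<bar> \<le> 12 * k\<^sup>2 + 5 * k"
    by linarith+
  show "\<bar>k\<bar> \<le> 12 * k\<^sup>2 - 13 * k + 3"
  \<comment> \<open>Against \<open>- 13 * k\<close> the estimate
    \<open>\<bar>k\<bar> \<le> k\<^sup>2\<close> is too weak; from absolute value \<open>2\<close>
    on there is a further factor \<open>2\<close>, and three values remain to be checked.\<close>
  proof (cases "2 \<le> \<bar>k\<bar>")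
    case True
    then have "2 * \<bar>k\<bar> \<le> \<bar>k\<bar> * \<bar>k\<bar>" by (intro mult_right_mono) auto
    then show ?thesis by (simp add: power2_eq_square)
  next
    case False
    then have "k = -1 \<or> k = 0 \<or> k = 1" by linarith
    then show ?thesis by auto
  qed
qed

lemma vnorm_power_diff_le:
  fixes q :: "'a::valued_ring"
  assumes "vnorm q < 1" "\<bar>k\<bar> \<le> a" "\<bar>k\<bar> \<le> b"
  shows "vnorm (q ^ nat a - q ^ nat b) \<le> 2 * vnorm q ^ nat \<bar>k\<bar>"
proof -
  have "vnorm (q ^ nat a - q ^ nat b) \<le> vnorm q ^ nat a + vnorm q ^ nat b"
    using vnorm_diff_le[of "q ^ nat a" "q ^ nat b"] by (simp add: vnorm_power)
  also have "\<dots> \<le> vnorm q ^ nat \<bar>k\<bar> + vnorm q ^ nat \<bar>k\<bar>"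
    using assms by (intro add_mono power_decreasing nat_mono) auto
  finally show ?thesis by simp
qed

lemma summable_on_even_term:
  fixes q :: "'a::valued_ring"
  assumes "vnorm q < 1" shows "even_term q summable_on UNIV"
  using assms unfolding even_term_def[abs_def]
  by (intro summable_on_int_geometric[of "vnorm q" 2] vnorm_power_diff_le exponent_bounds) auto

lemma summable_on_odd_term:
  fixes q :: "'a::valued_ring"
  assumes "vnorm q < 1" shows "odd_term q summable_on UNIV"
  using assms unfolding odd_term_def[abs_def]
  by (intro summable_on_int_geometric[of "vnorm q" 2] vnorm_power_diff_le exponent_bounds) auto

text \<open>\<^const>\<open>pent\<close> is even at the first two elements and odd at the last two.\<close>

definition residue_block :: "int \<Rightarrow> int set" where
  "residue_block j = {4 * j, 4 * j + 1, 2 - 4 * j, - 1 - 4 * j}"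

lemma pent_residue_block:
  "pent (4 * j) = 2 * nat (12 * j\<^sup>2 + j)"
  "pent (4 * j + 1) = 2 * nat (12 * j\<^sup>2 + 7 * j + 1)"
  "pent (2 - 4 * j) = 2 * nat (12 * j\<^sup>2 - 13 * j + 3) + 1"
  "pent (- 1 - 4 * j) = 2 * nat (12 * j\<^sup>2 + 5 * j) + 1"
  using exponent_bounds[of j]
  by (intro pentI, simp add: power2_eq_square algebra_simps)+

text \<open>One factor \<open>w\<close> comes out of the two odd powers. Their indices
  \<open>2 - 4 * j\<close> and \<open>- 1 - 4 * j\<close> are even and odd, which gives
  \<open>odd_term\<close> the coefficient \<open>- w\<close>.\<close>

lemma sum_residue_block:
  "(\<Sum>k\<in>residue_block j. pent_term w k) = even_term (w\<^sup>2) j - w * odd_term (w\<^sup>2) j"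
proof -
  have "(\<Sum>k\<in>residue_block j. pent_term w k)
      = pent_term w (4 * j) + (pent_term w (4 * j + 1) + (pent_term w (2 - 4 * j) + pent_term w (- 1 - 4 * j)))"
  proof -
    have "4 * j \<noteq> 2 - 4 * j" "4 * j \<noteq> - 1 - 4 * j" "4 * j + 1 \<noteq> 2 - 4 * j"
      "4 * j + 1 \<noteq> - 1 - 4 * j" by presburger+
    then show ?thesis by (simp add: residue_block_def)
  qed
  also have "\<dots> = even_term (w\<^sup>2) j - w * odd_term (w\<^sup>2) j"
    unfolding pent_term_def pent_residue_block even_term_def odd_term_def power_mult power_add
    by (simp add: algebra_simps)
  finally show ?thesis .
qed

section \<open>Regrouping the integers into blocks\<close>

lemma disjoint_residue_block: "i \<noteq> j \<Longrightarrow> residue_block i \<inter> residue_block j = {}"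
  unfolding residue_block_def by (auto; presburger)

text \<open>The four elements of a block represent the four classes modulo \<open>4\<close>. The
  bound on \<open>j\<close> puts \<open>k\<close> into the union of the blocks with
  \<open>\<bar>j\<bar> \<le> n\<close> as soon as \<open>n\<close> reaches
  \<open>\<bar>k\<bar>\<close>.\<close>

lemma residue_block_cover: "\<exists>j. \<bar>j\<bar> \<le> \<bar>k\<bar> \<and> k \<in> residue_block j"
proof -
  have "k = 4 * (k div 4) \<or> k = 4 * (k div 4) + 1 \<or> k = 2 - 4 * (- (k div 4))
    \<or> k = - 1 - 4 * (- (k div 4) - 1)"
    by presburger
  then consider "k = 4 * (k div 4)" | "k = 4 * (k div 4) + 1" | "k = 2 - 4 * (- (k div 4))"
    | "k = - 1 - 4 * (- (k div 4) - 1)"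
    by blast
  then show ?thesis
  proof cases
    case 1 then show ?thesis by (intro exI[of _ "k div 4"]) (auto simp: residue_block_def; presburger)
  next
    case 2 then show ?thesis by (intro exI[of _ "k div 4"]) (auto simp: residue_block_def; presburger)
  next
    case 3 then show ?thesis by (intro exI[of _ "- (k div 4)"]) (auto simp: residue_block_def; presburger)
  next
    case 4 then show ?thesis by (intro exI[of _ "- (k div 4) - 1"]) (auto simp: residue_block_def; presburger)
  qed
qed

lemma has_sum_int_LIMSEQ:
  fixes f :: "int \<Rightarrow> 'a::{comm_monoid_add, topological_space}"
  assumes "(f has_sum l) UNIV"
  shows "(\<lambda>n. \<Sum>k\<in>{- int n..int n}. f k) \<longlonglongrightarrow> l"
proof (rule has_sum_imp_LIMSEQ[OF assms])
  fix i :: int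
  show "\<forall>\<^sub>F n in sequentially. i \<in> {- int n..int n}"
    by (rule eventually_sequentiallyI[of "nat \<bar>i\<bar>"]) auto
qed simp

text \<open>Summing the pentagonal series along finite unions of blocks confines the regrouping to
  finite sums.\<close>

lemma pentagonal_dissection:
  fixes w :: "'a::valued_ring"
  assumes w: "vnorm w < 1"
    and A: "(even_term (w\<^sup>2) has_sum A) UNIV" and B: "(odd_term (w\<^sup>2) has_sum B) UNIV"
  shows "qpoch_inf w = A - w * B"
proof (rule LIMSEQ_unique)
  let ?I = "\<lambda>n. {- int n..int n}"
  show "(\<lambda>n. \<Sum>k\<in>(\<Union>j\<in>?I n. residue_block j). pent_term w k) \<longlonglongrightarrow> qpoch_inf w"
  proof (rule has_sum_imp_LIMSEQ[OF pentagonal[OF w]])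
    fix k
    obtain j where j: "\<bar>j\<bar> \<le> \<bar>k\<bar>" "k \<in> residue_block j" using residue_block_cover by blast
    have "j \<in> ?I n" if "nat \<bar>k\<bar> \<le> n" for n using j(1) that by auto
    then show "\<forall>\<^sub>F n in sequentially. k \<in> (\<Union>j\<in>?I n. residue_block j)"
      using j(2) by (intro eventually_sequentiallyI[of "nat \<bar>k\<bar>"]) blast
  qed (simp add: residue_block_def)
  have "(\<Sum>k\<in>(\<Union>j\<in>?I n. residue_block j). pent_term w k)
      = (\<Sum>j\<in>?I n. even_term (w\<^sup>2) j) - w * (\<Sum>j\<in>?I n. odd_term (w\<^sup>2) j)" for n
  proof -
    have "(\<Sum>k\<in>(\<Union>j\<in>?I n. residue_block j). pent_term w k)
        = (\<Sum>j\<in>?I n. \<Sum>k\<in>residue_block j. pent_term w k)"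
      by (rule sum.UNION_disjoint) (simp_all add: disjoint_residue_block, simp add: residue_block_def)
    then show ?thesis by (simp add: sum_residue_block sum_subtractf sum_distrib_left)
  qed
  then show "(\<lambda>n. \<Sum>k\<in>(\<Union>j\<in>?I n. residue_block j). pent_term w k) \<longlonglongrightarrow> A - w * B"
    by (simp only:) (intro valued_tendsto_diff valued_tendsto_mult tendsto_const has_sum_int_LIMSEQ A B)
qed

text \<open>Euler's series is summed in pairs \<open>m = 2 * n\<close> and
  \<open>m = 2 * n + 1\<close>. The parts stay in one equation because they are separated
  differently in the two rings: by the sign of \<open>w\<close>, or by the parity of
  degrees.\<close>

lemma dissection_identity:
  fixes w :: "'a::valued_ring"
  assumes w: "vnorm w < 1" and rcp: "\<And>m. rcp m * qpoch (w\<^sup>2) m = 1"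
    and A: "(\<lambda>n. (w\<^sup>2) ^ (2 * n^2) * rcp (2 * n)) sums A"
    and B: "(\<lambda>n. (w\<^sup>2) ^ (2 * n^2 + 2 * n) * rcp (2 * n + 1)) sums B"
    and A': "(even_term (w\<^sup>2) has_sum A') UNIV" and B': "(odd_term (w\<^sup>2) has_sum B') UNIV"
  shows "qpoch_inf (w\<^sup>2) * (A - w * B) = A' - w * B'"
proof -
  let ?t = "\<lambda>m. (- 1) ^ m * w ^ (m * m) * rcp m"
  obtain L where L: "(\<lambda>M. \<Sum>m<M. ?t m) \<longlonglongrightarrow> L" "qpoch_inf (w\<^sup>2) * L = qpoch_inf w"
    using euler[OF w rcp] by blast
  have "(\<lambda>N. \<Sum>m<2 * N. ?t m) \<longlonglongrightarrow> L"
    using LIMSEQ_subseq_LIMSEQ[OF L(1), of "\<lambda>N. 2 * N"] by (simp add: strict_mono_def o_def)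
  moreover have "(\<Sum>m<2 * N. ?t m) = (\<Sum>n<N. (w\<^sup>2) ^ (2 * n^2) * rcp (2 * n))
      - w * (\<Sum>n<N. (w\<^sup>2) ^ (2 * n^2 + 2 * n) * rcp (2 * n + 1))" for N
  proof (induction N)
    case (Suc N)
    have t1: "?t (2 * N) = (w\<^sup>2) ^ (2 * N^2) * rcp (2 * N)"
      by (simp only: power_mult[symmetric]) (simp add: power2_eq_square mult_ac)
    have t2: "?t (2 * N + 1) = - w * ((w\<^sup>2) ^ (2 * N^2 + 2 * N) * rcp (2 * N + 1))"
    proof -
      have e: "w ^ ((2 * N + 1) * (2 * N + 1)) = w * (w\<^sup>2) ^ (2 * N^2 + 2 * N)"
        by (simp only: power_mult[symmetric] power_Suc[symmetric]) (simp add: power2_eq_square algebra_simps)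
      show ?thesis unfolding e by simp
    qed
    have "(\<Sum>m<2 * Suc N. ?t m) = (\<Sum>m<2 * N. ?t m) + ?t (2 * N) + ?t (2 * N + 1)"
      by simp
    then show ?case
      by (simp only: t1 t2 Suc.IH sum.lessThan_Suc) (simp add: algebra_simps)
  qed simp
  ultimately have "(\<lambda>N. (\<Sum>n<N. (w\<^sup>2) ^ (2 * n^2) * rcp (2 * n))
      - w * (\<Sum>n<N. (w\<^sup>2) ^ (2 * n^2 + 2 * n) * rcp (2 * n + 1))) \<longlonglongrightarrow> L" by simp
  moreover have "(\<lambda>N. (\<Sum>n<N. (w\<^sup>2) ^ (2 * n^2) * rcp (2 * n))
      - w * (\<Sum>n<N. (w\<^sup>2) ^ (2 * n^2 + 2 * n) * rcp (2 * n + 1))) \<longlonglongrightarrow> A - w * B"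
    using A B unfolding sums_def by (intro valued_tendsto_diff valued_tendsto_mult tendsto_const)
  ultimately have "L = A - w * B" by (rule LIMSEQ_unique)
  then show ?thesis using L(2) pentagonal_dissection[OF w A' B'] by simp
qed

lemma summable_qpoch_series:
  fixes q :: "'a::valued_ring"
  assumes q: "vnorm q < 1" and rcp: "\<And>m. rcp m * qpoch q m = 1" and e: "\<And>n. n \<le> e n"
  shows "summable (\<lambda>n. q ^ e n * rcp (f n))"
proof (rule summable_geometric_bound)
  show "vnorm (q ^ e n * rcp (f n)) \<le> exp (1 / (1 - vnorm q)\<^sup>2) * vnorm q ^ n" for n
    unfolding vnorm_mult vnorm_power mult.commute[of "vnorm q ^ e n"]
    using q e by (intro mult_mono power_decreasing vnorm_qpoch_inverse_le[OF q rcp]) auto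
qed (use q in auto)

section \<open>Complex numbers and formal power series\<close>

instance complex :: valued_ring
  by standard (simp_all add: dist_norm norm_mult)

instance fps :: (field) valued_ring
proof
  fix x y z :: "'a fps"
  show "dist (x + z) (y + z) = dist x y" by (simp add: dist_fps_def)
  show "dist (x * y) 0 = dist x 0 * dist y 0"
    by (auto simp: dist_fps_def power_add)
qed

lemma vnorm_complex: "vnorm (z :: complex) = norm z"
  by (simp add: vnorm_def)

lemma vnorm_fps_X: "vnorm (fps_X :: 'a::field fps) = 1 / 2"
  by (simp add: vnorm_def dist_fps_def)

text \<open>At \<open>q = 0\<close> the square root is zero and the dissection says nothing about
  the odd parts; both sides reduce to their terms at index zero.\<close>

lemma complex_identity_zero:
  "(\<Sum>n. (0::complex) ^ (2 * n\<^sup>2 + 2 * n) * inverse (qpoch 0 (2 * n + 1))) = 1"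
  "(\<Sum>\<^sub>\<infinity>k. odd_term (0::complex) k) = 1" "qpoch_inf (0::complex) = 1"
proof -
  have qpoch: "qpoch (0::complex) n = 1" for n
    unfolding qpoch_def by (rule prod.neutral) auto
  have "(\<lambda>n. (0::complex) ^ (2 * n\<^sup>2 + 2 * n) * inverse (qpoch 0 (2 * n + 1))) sums 1"
    using sums_single[of 0 "\<lambda>_. 1::complex"] by (simp add: qpoch power_0_left cong: if_cong)
  then show "(\<Sum>n. (0::complex) ^ (2 * n\<^sup>2 + 2 * n) * inverse (qpoch 0 (2 * n + 1))) = 1"
    by (simp add: sums_iff)
  have "odd_term (0::complex) k = (if k = 0 then 1 else 0)" for k
    using exponent_bounds(3,4)[of k] by (cases "k = 0") (auto simp: odd_term_def power_0_left)
  then have "(\<Sum>\<^sub>\<infinity>k. odd_term (0::complex) k) = (\<Sum>\<^sub>\<infinity>k\<in>{0::int}. 1)"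
    by (intro infsum_cong_neutral) auto
  then show "(\<Sum>\<^sub>\<infinity>k. odd_term (0::complex) k) = 1" by simp
  have "qpoch (0::complex) \<longlonglongrightarrow> 1" by (simp add: qpoch[abs_def])
  then show "qpoch_inf (0::complex) = 1"
    using qpoch_LIMSEQ[of "0::complex"] LIMSEQ_unique by (fastforce simp: vnorm_complex)
qed

text \<open>Both square roots \<open>w\<close> and \<open>- w\<close> of \<open>q\<close> satisfy
  the dissection identity with the same four sums. Subtracting removes the even parts and leaves
  \<open>2 * w\<close> times the claim, where \<open>w\<close> is nonzero.\<close>

lemma complex_identity:
  fixes q :: complex
  assumes q: "norm q < 1"
  shows "(\<Sum>n. q ^ (2 * n\<^sup>2 + 2 * n) * inverse (qpoch q (2 * n + 1)))
    = 1 / qpoch_inf q * (\<Sum>\<^sub>\<infinity>k. odd_term q k)"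
proof (cases "q = 0")
  case True
  then show ?thesis using complex_identity_zero by simp
next
  case False
  have vq: "vnorm q < 1" using q by (simp add: vnorm_complex)
  define w where "w = csqrt q"
  have w: "w\<^sup>2 = q" "w \<noteq> 0" using False by (auto simp: w_def)
  have "norm w ^ 2 < 1\<^sup>2" using q by (simp add: w flip: norm_power)
  then have nw: "vnorm w < 1" "vnorm (- w) < 1"
    unfolding vnorm_minus unfolding vnorm_complex by (simp_all add: power2_less_imp_less)
  let ?rcp = "\<lambda>m. inverse (qpoch q m)"
  have rcp: "?rcp m * qpoch q m = 1" for m using qpoch_nonzero[OF vq] by simp
  define A where "A = (\<Sum>n. q ^ (2 * n\<^sup>2) * ?rcp (2 * n))"
  define B where "B = (\<Sum>n. q ^ (2 * n\<^sup>2 + 2 * n) * ?rcp (2 * n + 1))"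
  define A' where "A' = (\<Sum>\<^sub>\<infinity>k. even_term q k)"
  define B' where "B' = (\<Sum>\<^sub>\<infinity>k. odd_term q k)"
  have "n \<le> 2 * n\<^sup>2" for n :: nat by (cases n) (auto simp: power2_eq_square)
  then have A: "(\<lambda>n. q ^ (2 * n\<^sup>2) * ?rcp (2 * n)) sums A"
    unfolding A_def by (intro summable_sums summable_qpoch_series[OF vq, of ?rcp] rcp)
  have B: "(\<lambda>n. q ^ (2 * n\<^sup>2 + 2 * n) * ?rcp (2 * n + 1)) sums B"
    unfolding B_def by (intro summable_sums summable_qpoch_series[OF vq, of ?rcp] rcp) simp
  have A': "(even_term q has_sum A') UNIV"
    unfolding A'_def by (intro has_sum_infsum summable_on_even_term vq)
  have B': "(odd_term q has_sum B') UNIV"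
    unfolding B'_def by (intro has_sum_infsum summable_on_odd_term vq)
  have identity: "qpoch_inf q * (A - v * B) = A' - v * B'" if "vnorm v < 1" "v\<^sup>2 = q" for v
    using dissection_identity[of v ?rcp A B A' B'] that rcp A B A' B' by simp
  have "2 * w * (qpoch_inf q * B) = 2 * w * B'"
    using identity[OF nw(1)] identity[OF nw(2)] w(1) by (simp add: algebra_simps) algebra
  then have "qpoch_inf q * B = B'" using w(2) by simp
  then have "B = 1 / qpoch_inf q * B'"
    using qpoch_limit_nonzero[OF vq qpoch_LIMSEQ[OF vq]] by (auto simp: field_simps)
  then show ?thesis by (simp only: B_def B'_def)
qed

text \<open>
  Since \<^const>\<open>fps_X\<close> has no square root, the identity is proved at \<open>fps_X\<^sup>2\<close>, where the parity of
  the exponents separates the two parts also in characteristic two.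
\<close>

definition fps_double :: "'a::comm_ring_1 fps \<Rightarrow> 'a fps" where
  "fps_double f = f oo fps_X\<^sup>2"

lemma fps_double_nth: "fps_nth (fps_double f) n = (if even n then fps_nth f (n div 2) else 0)"
  by (simp add: fps_double_def fps_nth_compose_X_power)

lemma fps_double_1 [simp]: "fps_double 1 = 1"
  by (simp add: fps_double_def)

lemma fps_double_diff: "fps_double (f - g) = fps_double f - fps_double g"
  by (rule fps_ext) (simp add: fps_double_nth)

lemma fps_double_sum: "fps_double (\<Sum>i\<in>A. f i) = (\<Sum>i\<in>A. fps_double (f i))"
  by (simp add: fps_double_def fps_compose_sum_distrib)

lemma fps_double_mult:
  fixes f g :: "'a::idom fps"
  shows "fps_double (f * g) = fps_double f * fps_double g"
  unfolding fps_double_def by (rule fps_compose_mult_distrib) simp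

lemma fps_double_X_power:
  fixes n :: nat
  shows "fps_double (fps_X ^ n :: 'a::idom fps) = (fps_X\<^sup>2) ^ n"
  by (induction n) (simp_all add: fps_double_mult, simp add: fps_double_def)

lemma fps_double_qpoch: "fps_double (qpoch (fps_X :: 'a::idom fps) n) = qpoch (fps_X\<^sup>2) n"
proof (induction n)
  case (Suc n)
  then show ?case
    by (simp only: qpoch_Suc fps_double_mult fps_double_diff fps_double_1 fps_double_X_power)
qed simp

text \<open>Convergence is coefficientwise, and every coefficient of the double is a coefficient of
  the original or zero. Limits and sums at \<open>fps_X\<close> thus carry over to
  \<open>fps_X\<^sup>2\<close>.\<close>

lemma tendsto_fps_double:
  assumes "(f \<longlongrightarrow> l) F"
  shows "((\<lambda>x. fps_double (f x)) \<longlongrightarrow> fps_double l) F"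
  using assms unfolding tendsto_fps_iff fps_double_nth
  by (auto elim: eventually_mono)

lemma sums_fps_double: "f sums l \<Longrightarrow> (\<lambda>n. fps_double (f n)) sums fps_double l"
  unfolding sums_def fps_double_sum[symmetric] by (rule tendsto_fps_double)

lemma has_sum_fps_double:
  "(f has_sum l) A \<Longrightarrow> ((\<lambda>k. fps_double (f k)) has_sum fps_double l) A"
  using tendsto_fps_double[of "sum f" l] unfolding has_sum_def fps_double_sum by simp

text \<open>In degree \<open>2 * n + 1\<close> the doubled series \<open>a\<close> and
  \<open>a'\<close> vanish, and multiplication by \<open>fps_X\<close> moves coefficient
  \<open>n\<close> of \<open>b\<close> there.\<close>

lemma fps_double_parity:
  assumes "fps_double a - fps_X * fps_double b = fps_double a' - fps_X * fps_double b'"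
  shows "b = b'"
proof (rule fps_ext)
  fix n
  show "fps_nth b n = fps_nth b' n"
    using arg_cong[OF assms, of "\<lambda>f. fps_nth f (2 * n + 1)"] by (simp add: fps_double_nth)
qed

section \<open>The identity for formal power series\<close>

lemma qpoch_fps_X_nth_0 [simp]: "fps_nth (qpoch fps_X n) 0 = (1 :: 'a::comm_ring_1)"
  by (induction n) (simp_all add: qpoch_Suc)

text \<open>The dissection is applied with \<open>w = X\<close>, hence at \<open>X\<^sup>2\<close>.
  All its ingredients are doubles of their counterparts at \<open>X\<close>, so the parity of
  degrees isolates the equation of the odd parts.\<close>

lemma fps_identity:
  defines "X \<equiv> fps_X :: 'a::field fps"
  shows "(\<Sum>n. X ^ (2 * n\<^sup>2 + 2 * n) * inverse (qpoch X (2 * n + 1)))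
    = 1 / qpoch_inf X * (\<Sum>\<^sub>\<infinity>k. odd_term X k)"
proof -
  have X: "vnorm X < 1" by (simp add: X_def vnorm_fps_X)
  then have X2: "vnorm (X\<^sup>2) < 1"
    by (simp add: vnorm_power X_def vnorm_fps_X power_divide)
  let ?rcp = "\<lambda>m. inverse (qpoch X m)"
  have rcp: "?rcp m * qpoch X m = 1" for m
    by (intro inverse_mult_eq_1) (simp add: X_def)
  define A where "A = (\<Sum>n. X ^ (2 * n\<^sup>2) * ?rcp (2 * n))"
  define B where "B = (\<Sum>n. X ^ (2 * n\<^sup>2 + 2 * n) * ?rcp (2 * n + 1))"
  define A' where "A' = (\<Sum>\<^sub>\<infinity>k. even_term X k)"
  define B' where "B' = (\<Sum>\<^sub>\<infinity>k. odd_term X k)"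
  have "n \<le> 2 * n\<^sup>2" for n :: nat by (cases n) (auto simp: power2_eq_square)
  then have A: "(\<lambda>n. X ^ (2 * n\<^sup>2) * ?rcp (2 * n)) sums A"
    unfolding A_def by (intro summable_sums summable_qpoch_series[OF X, of ?rcp] rcp)
  have B: "(\<lambda>n. X ^ (2 * n\<^sup>2 + 2 * n) * ?rcp (2 * n + 1)) sums B"
    unfolding B_def by (intro summable_sums summable_qpoch_series[OF X, of ?rcp] rcp) simp
  have A': "(even_term X has_sum A') UNIV"
    unfolding A'_def by (intro has_sum_infsum summable_on_even_term X)
  have B': "(odd_term X has_sum B') UNIV"
    unfolding B'_def by (intro has_sum_infsum summable_on_odd_term X)
  have inf: "qpoch_inf (X\<^sup>2) = fps_double (qpoch_inf X)"
  proof (rule LIMSEQ_unique[OF qpoch_LIMSEQ[OF X2]])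
    show "qpoch (X\<^sup>2) \<longlonglongrightarrow> fps_double (qpoch_inf X)"
      using tendsto_fps_double[OF qpoch_LIMSEQ[OF X]] by (simp add: X_def fps_double_qpoch)
  qed
  have "qpoch_inf (X\<^sup>2) * (fps_double A - X * fps_double B) = fps_double A' - X * fps_double B'"
  proof (rule dissection_identity[where rcp = "\<lambda>m. fps_double (?rcp m)", OF X])
    show "fps_double (?rcp m) * qpoch (X\<^sup>2) m = 1" for m
      using rcp by (simp add: X_def flip: fps_double_qpoch fps_double_mult)
    show "(\<lambda>n. (X\<^sup>2) ^ (2 * n\<^sup>2) * fps_double (?rcp (2 * n))) sums fps_double A"
      using sums_fps_double[OF A] by (simp only: X_def fps_double_mult fps_double_X_power)
    show "(\<lambda>n. (X\<^sup>2) ^ (2 * n\<^sup>2 + 2 * n) * fps_double (?rcp (2 * n + 1))) sums fps_double B"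
      using sums_fps_double[OF B] by (simp only: X_def fps_double_mult fps_double_X_power)
    show "(even_term (X\<^sup>2) has_sum fps_double A') UNIV"
      using has_sum_fps_double[OF A']
      by (simp only: X_def even_term_def[abs_def] fps_double_diff fps_double_X_power)
    show "(odd_term (X\<^sup>2) has_sum fps_double B') UNIV"
      using has_sum_fps_double[OF B']
      by (simp only: X_def odd_term_def[abs_def] fps_double_diff fps_double_X_power)
  qed
  then have "fps_double (qpoch_inf X * A) - X * fps_double (qpoch_inf X * B)
      = fps_double A' - X * fps_double B'"
    by (simp add: inf fps_double_mult algebra_simps)
  then have PB: "qpoch_inf X * B = B'"
    unfolding X_def by (rule fps_double_parity)
  \<comment> \<open>The constant coefficient of the limit is an eventual value of those of the
    partial products, namely \<open>1\<close>; this makes \<open>qpoch_inf X\<close> a unit, so the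
    division is exact.\<close>
  have "\<forall>\<^sub>F n in sequentially. fps_nth (qpoch X n) 0 = fps_nth (qpoch_inf X) 0"
    using qpoch_LIMSEQ[OF X] unfolding tendsto_fps_iff by blast
  then have "fps_nth (qpoch_inf X) 0 = 1"
    by (simp add: X_def)
  then have "B = 1 / qpoch_inf X * B'"
    unfolding PB[symmetric] mult.assoc[symmetric]
    by (simp add: fps_divide_unit inverse_mult_eq_1)
  then show ?thesis by (simp only: B_def B'_def)
qed

text \<open>Both readings are covered, formal over an arbitrary field and analytic in the unit disc.
  Convergence is asserted explicitly because the sum and product operators are total and take some
  value even without it.\<close>

theorem corollary5p8:
  shows
    "(let X = (fps_X :: 'a::field fps) in
        summable (\<lambda>n. X ^ (2 * n^2 + 2 * n) / qpoch X (2 * n + 1)) \<and>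
        convergent_prod (\<lambda>j. 1 - X ^ Suc j) \<and>
        (\<lambda>k::int. X ^ nat (12 * k^2 + 5 * k) - X ^ nat (12 * k^2 - 13 * k + 3)) summable_on UNIV \<and>
        (\<Sum>n. X ^ (2 * n^2 + 2 * n) / qpoch X (2 * n + 1)) =
          1 / qpoch_inf X *
            (\<Sum>\<^sub>\<infinity>k::int. X ^ nat (12 * k^2 + 5 * k) - X ^ nat (12 * k^2 - 13 * k + 3)))
     \<and>
     (\<forall>q::complex. norm q < 1 \<longrightarrow>
        summable (\<lambda>n. q ^ (2 * n^2 + 2 * n) / qpoch q (2 * n + 1)) \<and>
        convergent_prod (\<lambda>j. 1 - q ^ Suc j) \<and>
        (\<lambda>k::int. q ^ nat (12 * k^2 + 5 * k) - q ^ nat (12 * k^2 - 13 * k + 3)) summable_on UNIV \<and>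
        (\<Sum>n. q ^ (2 * n^2 + 2 * n) / qpoch q (2 * n + 1)) =
          1 / qpoch_inf q *
            (\<Sum>\<^sub>\<infinity>k::int. q ^ nat (12 * k^2 + 5 * k) - q ^ nat (12 * k^2 - 13 * k + 3)))"
proof (unfold Let_def odd_term_def[symmetric], intro conjI allI impI)
  let ?X = "fps_X :: 'a fps"
  have X: "vnorm ?X < 1" by (simp add: vnorm_fps_X)
  \<comment> \<open>Division of power series is multiplication by the inverse here because
    \<open>qpoch\<close> at \<open>fps_X\<close> has constant coefficient \<open>1\<close>.\<close>
  have div: "f / qpoch ?X m = f * inverse (qpoch ?X m)" for f m
    by (intro fps_divide_unit) simp
  show "summable (\<lambda>n. ?X ^ (2 * n^2 + 2 * n) / qpoch ?X (2 * n + 1))"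
    unfolding div using X
    by (rule summable_qpoch_series[where rcp = "\<lambda>m. inverse (qpoch ?X m)"])
      (simp_all add: inverse_mult_eq_1)
  show "convergent_prod (\<lambda>j. 1 - ?X ^ Suc j)"
    using has_prod_qpoch[OF X] by (auto simp: has_prod_def convergent_prod_def)
  show "odd_term ?X summable_on UNIV" by (rule summable_on_odd_term[OF X])
  show "(\<Sum>n. ?X ^ (2 * n^2 + 2 * n) / qpoch ?X (2 * n + 1))
      = 1 / qpoch_inf ?X * (\<Sum>\<^sub>\<infinity>k. odd_term ?X k)"
    unfolding div by (rule fps_identity)
next
  fix q :: complex assume q: "norm q < 1"
  then have vq: "vnorm q < 1" by (simp add: vnorm_complex)
  show "summable (\<lambda>n. q ^ (2 * n^2 + 2 * n) / qpoch q (2 * n + 1))"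
    unfolding divide_inverse using vq
    by (rule summable_qpoch_series[where rcp = "\<lambda>m. inverse (qpoch q m)"])
      (simp_all add: qpoch_nonzero[OF vq])
  show "convergent_prod (\<lambda>j. 1 - q ^ Suc j)"
    using has_prod_qpoch[OF vq] by (auto simp: has_prod_def convergent_prod_def)
  show "odd_term q summable_on UNIV" by (rule summable_on_odd_term[OF vq])
  show "(\<Sum>n. q ^ (2 * n^2 + 2 * n) / qpoch q (2 * n + 1))
      = 1 / qpoch_inf q * (\<Sum>\<^sub>\<infinity>k. odd_term q k)"
    using complex_identity[OF q] by (simp only: divide_inverse)
qed

end
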